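(* Every connected cubic graph $H$ not isomorphic to $K_4$ or $K_{3,3}$ is $\mathcal{M}$-independent for every $2$-rigidity family $\mathcal{M}$.
   Context: Graphs are identified with their edge sets (no isolated vertices); a graph on $[n]$ is a subset of $\binom{[n]}{2}$. A graph matroid $\mathcal{M}_n$ on $\binom{[n]}{2}$ is symmetric if independence is invariant under relabelling vertices. A sequence $\mathcal{M}=(\mathcal{M}_n)_{n\geq 2}$ of symmetric graph matroids is a matroidal family if every graph that is $\mathcal{M}_n$-independent for some $n$ is $\mathcal{M}_n$-independent for all $n\geq v(G)$; then "$G$ is $\mathcal{M}$-independent" is well defined. A $2$-rigidity family is a matroidal family in which each $\mathcal{M}_n$ has rank $2n-3$. *)

theory Defs
  imports "HOL-Library.Ramsey" "HOL-Combinatorics.Permutations"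
begin

text \<open>
  A finite simple graph is identified with its set of edges, each edge being a
  two-element set of vertices; in particular there are no isolated vertices.
\<close>

definition simple_graph :: "'a set set \<Rightarrow> bool" where
  "simple_graph G \<longleftrightarrow> finite G \<and> (\<forall>e\<in>G. card e = 2)"

abbreviation graph_vertices :: "'a set set \<Rightarrow> 'a set" where
  "graph_vertices G \<equiv> \<Union> G"

definition relabel :: "('a \<Rightarrow> 'b) \<Rightarrow> 'a set set \<Rightarrow> 'b set set" where
  "relabel f G = (\<lambda>e. f ` e) ` G"

definition graph_iso :: "'a set set \<Rightarrow> 'b set set \<Rightarrow> bool" where
  "graph_iso G H \<longleftrightarrow>
     (\<exists>f. bij_betw f (graph_vertices G) (graph_vertices H) \<and> relabel f G = H)"

definition vertex_degree :: "'a set set \<Rightarrow> 'a \<Rightarrow> nat" where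
  "vertex_degree G v = card {e \<in> G. v \<in> e}"

definition cubic_graph :: "'a set set \<Rightarrow> bool" where
  "cubic_graph G \<longleftrightarrow> (\<forall>v\<in>graph_vertices G. vertex_degree G v = 3)"

definition connected_graph :: "'a set set \<Rightarrow> bool" where
  "connected_graph G \<longleftrightarrow> G \<noteq> {} \<and>
     (\<forall>u\<in>graph_vertices G. \<forall>v\<in>graph_vertices G. (u, v) \<in> {(x, y). {x, y} \<in> G}\<^sup>*)"

definition complete_edges :: "nat \<Rightarrow> nat set set" where
  "complete_edges n = nsets {1..n} 2"

definition complete_bipartite_edges :: "nat \<Rightarrow> nat \<Rightarrow> nat set set" where
  "complete_bipartite_edges m n = {{a, b} | a b. a \<in> {1..m} \<and> b \<in> {m+1..m+n}}"

locale matroid =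
  fixes ground :: "'a set" and ind :: "'a set \<Rightarrow> bool"
  assumes finite_ground: "finite ground"
    and indep_subset_ground: "ind X \<Longrightarrow> X \<subseteq> ground"
    and indep_empty: "ind {}"
    and indep_mono: "ind Y \<Longrightarrow> X \<subseteq> Y \<Longrightarrow> ind X"
    and indep_augment:
      "ind X \<Longrightarrow> ind Y \<Longrightarrow> card X < card Y \<Longrightarrow> \<exists>y\<in>Y - X. ind (insert y X)"

definition matroid_rank :: "('a set \<Rightarrow> bool) \<Rightarrow> nat" where
  "matroid_rank ind = Max (card ` {X. ind X})"

definition symmetric_graph_matroid :: "nat \<Rightarrow> (nat set set \<Rightarrow> bool) \<Rightarrow> bool" where
  "symmetric_graph_matroid n ind \<longleftrightarrow>
     matroid (complete_edges n) ind \<and>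
     (\<forall>p X. p permutes {1..n} \<longrightarrow> (ind (relabel p X) \<longleftrightarrow> ind X))"

text \<open>
  An abstract graph is independent in a matroid on the edges of the complete graph
  on \<open>{1..n}\<close> if it has an independent copy there. For symmetric graph matroids this
  does not depend on the copy.
\<close>

definition indep_copy :: "nat \<Rightarrow> (nat set set \<Rightarrow> bool) \<Rightarrow> 'a set set \<Rightarrow> bool" where
  "indep_copy n ind G \<longleftrightarrow>
     (\<exists>f. inj_on f (graph_vertices G) \<and> f ` graph_vertices G \<subseteq> {1..n} \<and> ind (relabel f G))"

lemma indep_copy_iff_all:
  assumes sym: "symmetric_graph_matroid n ind"
    and fits: "finite (graph_vertices G)" "card (graph_vertices G) \<le> n"
  shows "indep_copy n ind G \<longleftrightarrow>
     (\<forall>f. inj_on f (graph_vertices G) \<and> f ` graph_vertices G \<subseteq> {1..n} \<longrightarrow> ind (relabel f G))"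
proof
  let ?V = "graph_vertices G"
  assume "indep_copy n ind G"
  then obtain f where f: "inj_on f ?V" "f ` ?V \<subseteq> {1..n}" "ind (relabel f G)"
    unfolding indep_copy_def by blast
  show "\<forall>g. inj_on g ?V \<and> g ` ?V \<subseteq> {1..n} \<longrightarrow> ind (relabel g G)"
  proof (intro allI impI, elim conjE)
    fix g assume g: "inj_on g ?V" "g ` ?V \<subseteq> {1..n}"
    let ?h = "g \<circ> inv_into ?V f"
    have h: "bij_betw ?h (f ` ?V) (g ` ?V)"
      using bij_betw_trans[OF bij_betw_inv_into[OF inj_on_imp_bij_betw[OF f(1)]]
          inj_on_imp_bij_betw[OF g(1)]] .
    have "card (f ` ?V) = card (g ` ?V)"
      using f(1) g(1) by (simp add: card_image)
    then have "card ({1..n} - f ` ?V) = card ({1..n} - g ` ?V)"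
      using f(2) g(2) fits(1) by (simp add: card_Diff_subset)
    then obtain k where k: "bij_betw k ({1..n} - f ` ?V) ({1..n} - g ` ?V)"
      using finite_same_card_bij[of "{1..n} - f ` ?V" "{1..n} - g ` ?V"] by auto
    define p where "p x = (if x \<in> f ` ?V then ?h x else if x \<in> {1..n} then k x else x)" for x
    have "bij_betw p (f ` ?V) (g ` ?V)"
      using h by (rule bij_betw_cong[THEN iffD1, rotated]) (simp add: p_def)
    moreover have "bij_betw p ({1..n} - f ` ?V) ({1..n} - g ` ?V)"
      using k by (rule bij_betw_cong[THEN iffD1, rotated]) (simp add: p_def)
    ultimately have "bij_betw p (f ` ?V \<union> ({1..n} - f ` ?V)) (g ` ?V \<union> ({1..n} - g ` ?V))"
      by (rule bij_betw_combine) blast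
    moreover have "f ` ?V \<union> ({1..n} - f ` ?V) = {1..n}" "g ` ?V \<union> ({1..n} - g ` ?V) = {1..n}"
      using f(2) g(2) by blast+
    ultimately have "bij_betw p {1..n} {1..n}"
      by simp
    moreover have "p x = x" if "x \<notin> {1..n}" for x
      using that subsetD[OF f(2), of x] unfolding p_def by argo
    ultimately have p: "p permutes {1..n}"
      by (rule bij_imp_permutes)
    have pf: "p (f v) = g v" if "v \<in> ?V" for v
      using that f(1) by (simp add: p_def del: Union_iff)
    have "relabel p (relabel f G) = relabel g G"
      unfolding relabel_def image_image
    proof (rule image_cong[OF refl])
      fix e assume "e \<in> G"
      then show "(\<lambda>x. p (f x)) ` e = g ` e"
        using pf by (intro image_cong) auto
    qed
    then show "ind (relabel g G)"
      using sym p f(3) unfolding symmetric_graph_matroid_def by metis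
  qed
next
  let ?V = "graph_vertices G"
  assume all: "\<forall>f. inj_on f ?V \<and> f ` ?V \<subseteq> {1..n} \<longrightarrow> ind (relabel f G)"
  obtain f where "inj_on f ?V" "f ` ?V \<subseteq> {1..n}"
    using card_le_inj[OF fits(1), of "{1..n}"] fits(2) by auto
  then show "indep_copy n ind G"
    using all unfolding indep_copy_def by blast
qed

text \<open>
  The value of a family at 0 and 1 is irrelevant: a family is indexed by \<open>n \<ge> 2\<close>.
\<close>

definition matroidal_family :: "(nat \<Rightarrow> nat set set \<Rightarrow> bool) \<Rightarrow> bool" where
  "matroidal_family M \<longleftrightarrow>
     (\<forall>n\<ge>2. symmetric_graph_matroid n (M n)) \<and>
     (\<forall>G :: nat set set. simple_graph G \<longrightarrow>
        (\<exists>n\<ge>2. indep_copy n (M n) G) \<longrightarrow>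
        (\<forall>n\<ge>2. card (graph_vertices G) \<le> n \<longrightarrow> indep_copy n (M n) G))"

definition family_indep :: "(nat \<Rightarrow> nat set set \<Rightarrow> bool) \<Rightarrow> 'a set set \<Rightarrow> bool" where
  "family_indep M G \<longleftrightarrow> (\<exists>n\<ge>2. indep_copy n (M n) G)"

definition two_rigidity_family :: "(nat \<Rightarrow> nat set set \<Rightarrow> bool) \<Rightarrow> bool" where
  "two_rigidity_family M \<longleftrightarrow>
     matroidal_family M \<and> (\<forall>n\<ge>2. matroid_rank (M n) = 2 * n - 3)"

end

theory Submission
  imports Defs
begin

text \<open>
  Adding a vertex of degree at most two preserves independence in a 2-rigidity family, so every
  2-degenerate graph is independent; in particular all proper subgraphs of \<open>H\<close> are. Suppose
  \<open>H\<close> is dependent and some vertex \<open>s\<close> outside a cycle has exactly one neighbour on it.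
  Replacing \<open>s\<close> by a new vertex gives a second dependent copy, and circuit elimination makes the
  union of the two copies minus an edge of the cycle dependent, although it is 2-degenerate.
  Hence no such cycle exists. Applied to a shortest cycle this forces girth 3 or 4, and then
  looking at the third neighbours of the cycle vertices leaves only \<open>K\<^sub>4\<close> and \<open>K\<^sub>3\<^sub>,\<^sub>3\<close>.
\<close>

subsection \<open>Matroids\<close>

text \<open>Every vertex of \<open>H\<close> has degree three, so adding vertices of degree at most
  two never reaches \<open>H\<close> itself. Hence the detour through a contradiction: two dependent
  copies glued along everything except \<open>s\<close> form a dependent graph with an edge to
  spare. Doubling \<open>s\<close> raises precisely the neighbours of \<open>s\<close> to degree
  four. This is why the cycle may contain only one of them: after an edge of the cycle is deleted,
  vertices of degree two can be removed all round it, until the vertex of degree four has lost both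
  its neighbours on the cycle. What is left lies in a proper subgraph of \<open>H\<close>. The new
  vertex needs room, so the argument runs on one vertex more than \<open>H\<close> has; independence
  there suffices for independence in the family.\<close>

context matroid
begin

lemma indep_finite: "ind X \<Longrightarrow> finite X"
  using indep_subset_ground finite_ground finite_subset by blast

lemma augment_to_card:
  assumes "ind X" "ind Y" "card X \<le> card Y"
  shows "\<exists>W. X \<subseteq> W \<and> W \<subseteq> X \<union> Y \<and> ind W \<and> card W = card Y"
  using assms
proof (induction "card Y - card X" arbitrary: X)
  case 0
  then show ?case by (intro exI[of _ X]) auto
next
  case (Suc k)
  have "card X < card Y" using Suc.hyps(2) by linarith
  then obtain y where y: "y \<in> Y - X" "ind (insert y X)"
    using indep_augment[of X Y] Suc.prems by blast
  have "card (insert y X) = Suc (card X)"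
    using y(1) indep_finite[OF Suc.prems(1)] by simp
  then have "k = card Y - card (insert y X)" "card (insert y X) \<le> card Y"
    using Suc.hyps(2) by linarith+
  then obtain W where "insert y X \<subseteq> W" "W \<subseteq> insert y X \<union> Y" "ind W" "card W = card Y"
    using Suc.hyps(1)[of "insert y X"] y(2) Suc.prems(2) by metis
  then show ?case using y(1) by (intro exI[of _ W]) auto
qed

lemma card_le_matroid_rank:
  assumes "ind X"
  shows "card X \<le> matroid_rank ind"
proof -
  have "finite {X. ind X}"
    by (rule finite_subset[of _ "Pow ground"]) (use indep_subset_ground finite_ground in auto)
  then show ?thesis
    unfolding matroid_rank_def using assms by (intro Max_ge) auto
qed

lemma obtain_basis:
  obtains X where "ind X" "card X = matroid_rank ind"
proof -
  have "finite {X. ind X}"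
    by (rule finite_subset[of _ "Pow ground"]) (use indep_subset_ground finite_ground in auto)
  then have "matroid_rank ind \<in> card ` {X. ind X}"
    unfolding matroid_rank_def using indep_empty by (intro Max_in) auto
  then show ?thesis using that by auto
qed

text \<open>Circuit elimination for dependent sets that need not be circuits. If the union less
  \<open>e\<close> were independent, \<open>A \<inter> B\<close> would extend within
  \<open>A \<union> B\<close> to an independent set of the same size. That set misses a single
  element \<open>z\<close> outside \<open>A \<inter> B\<close>, so it contains all of
  \<open>A\<close> or all of \<open>B\<close>.\<close>

lemma dependent_Un_minus:
  assumes "\<not> ind A" "\<not> ind B" "ind (A \<inter> B)" "A \<noteq> B" "e \<in> A \<union> B"
  shows "\<not> ind (A \<union> B - {e})"
proof
  assume U: "ind (A \<union> B - {e})"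
  then have fin: "finite (A \<union> B)"
    using indep_finite by fastforce
  have "card (A \<inter> B) < card (A \<union> B)"
    using fin assms(4) by (intro psubset_card_mono) auto
  moreover have cU: "card (A \<union> B - {e}) = card (A \<union> B) - 1"
    using assms(5) by simp
  ultimately have "card (A \<inter> B) \<le> card (A \<union> B - {e})" by linarith
  then obtain W where W: "A \<inter> B \<subseteq> W" "W \<subseteq> (A \<inter> B) \<union> (A \<union> B - {e})" "ind W"
      "card W = card (A \<union> B) - 1"
    using augment_to_card[OF assms(3) U] cU by metis
  have "W \<subseteq> A \<union> B" using W(2) by blast
  moreover have "card (A \<union> B) > 0" using fin assms(5) by (auto simp: card_gt_0_iff)
  ultimately have "card (A \<union> B - W) = 1"
    using W(4) fin by (subst card_Diff_subset) (auto intro: finite_subset)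
  then obtain z where z: "A \<union> B - W = {z}" by (auto simp: card_1_singleton_iff)
  then have "x = z" if "x \<in> A \<union> B" "x \<notin> W" for x
    using that by (metis Diff_iff singletonD)
  moreover have "z \<notin> A \<inter> B" using z W(1) by blast
  ultimately have "A \<subseteq> W \<or> B \<subseteq> W" by blast
  then show False using assms(1,2) W(3) indep_mono by blast
qed

end

subsection \<open>Simple graphs\<close>

definition nbrs :: "'a set set \<Rightarrow> 'a \<Rightarrow> 'a set" where
  "nbrs G v = {w. {v, w} \<in> G}"

lemma nbrs_commute: "w \<in> nbrs G v \<longleftrightarrow> v \<in> nbrs G w"
  by (simp add: nbrs_def insert_commute)

lemma simple_graph_edge:
  assumes "simple_graph G" "e \<in> G"
  obtains x y where "e = {x, y}" "x \<noteq> y"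
  using assms unfolding simple_graph_def by (meson card_2_iff)

lemma simple_graph_edge_at:
  assumes "simple_graph G" "e \<in> G" "v \<in> e"
  obtains w where "e = {v, w}" "w \<noteq> v"
  using simple_graph_edge[OF assms(1,2)] assms(3)
  by (metis doubleton_eq_iff insertE singletonD)

lemma not_in_nbrs_self: "simple_graph G \<Longrightarrow> v \<notin> nbrs G v"
  by (auto simp: nbrs_def simple_graph_def)

lemma nbrs_vertices: "w \<in> nbrs G v \<Longrightarrow> w \<in> graph_vertices G \<and> v \<in> graph_vertices G"
  by (auto simp: nbrs_def)

lemma finite_graph_vertices: "simple_graph G \<Longrightarrow> finite (graph_vertices G)"
  unfolding simple_graph_def by (intro finite_Union) (auto intro: card_ge_0_finite)

lemma finite_nbrs: "simple_graph G \<Longrightarrow> finite (nbrs G v)"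
  by (rule finite_subset[OF _ finite_graph_vertices]) (auto dest: nbrs_vertices)

lemma vertex_degree_eq_card_nbrs:
  assumes "simple_graph G"
  shows "vertex_degree G v = card (nbrs G v)"
proof -
  have "bij_betw (\<lambda>w. {v, w}) (nbrs G v) {e \<in> G. v \<in> e}"
    unfolding bij_betw_def
  proof
    show "inj_on (\<lambda>w. {v, w}) (nbrs G v)"
      by (auto simp: inj_on_def doubleton_eq_iff)
    show "(\<lambda>w. {v, w}) ` nbrs G v = {e \<in> G. v \<in> e}"
    proof
      show "{e \<in> G. v \<in> e} \<subseteq> (\<lambda>w. {v, w}) ` nbrs G v"
      proof
        fix e assume e: "e \<in> {e \<in> G. v \<in> e}"
        then obtain w where w: "e = {v, w}"
          using simple_graph_edge_at[OF assms, of e v] by blast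
        then have "w \<in> nbrs G v" using e by (simp add: nbrs_def)
        then show "e \<in> (\<lambda>w. {v, w}) ` nbrs G v" unfolding w by (rule imageI)
      qed
      show "(\<lambda>w. {v, w}) ` nbrs G v \<subseteq> {e \<in> G. v \<in> e}"
        unfolding nbrs_def by blast
    qed
  qed
  then show ?thesis by (simp add: vertex_degree_def bij_betw_same_card)
qed

lemma nbrs_mono: "F \<subseteq> G \<Longrightarrow> nbrs F v \<subseteq> nbrs G v"
  by (auto simp: nbrs_def)

lemma connected_graph_closed:
  assumes "connected_graph G" "a \<in> W" "a \<in> graph_vertices G"
    and closed: "\<And>x. x \<in> W \<Longrightarrow> nbrs G x \<subseteq> W"
  shows "graph_vertices G \<subseteq> W"
proof
  fix v assume "v \<in> graph_vertices G"
  then have "(a, v) \<in> {(x, y). {x, y} \<in> G}\<^sup>*"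
    using assms(1,3) unfolding connected_graph_def by blast
  then show "v \<in> W"
    by (induction rule: rtrancl_induct) (use assms(2) closed in \<open>auto simp: nbrs_def\<close>)
qed

section \<open>Relabelling, and graphs inside a complete graph\<close>

lemma relabel_id_on:
  assumes "\<And>v. v \<in> graph_vertices G \<Longrightarrow> f v = v"
  shows "relabel f G = G"
proof -
  have "f ` e = e" if "e \<in> G" for e
    using assms that by (force simp: image_iff)
  then show ?thesis unfolding relabel_def by simp
qed

lemma graph_vertices_relabel: "graph_vertices (relabel f G) = f ` graph_vertices G"
  by (auto simp: relabel_def)

lemma inj_on_image_edges: "inj_on f (graph_vertices G) \<Longrightarrow> inj_on ((`) f) G"
  by (rule inj_on_subset[OF inj_on_image_Pow]) auto

lemma card_relabel: "inj_on f (graph_vertices G) \<Longrightarrow> card (relabel f G) = card G"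
  unfolding relabel_def by (intro card_image inj_on_image_edges)

lemma simple_graph_relabel:
  assumes "simple_graph G" "inj_on f (graph_vertices G)"
  shows "simple_graph (relabel f G)"
  unfolding simple_graph_def relabel_def
proof (intro conjI ballI)
  show "finite ((`) f ` G)" using assms(1) by (simp add: simple_graph_def)
  fix e assume "e \<in> (`) f ` G"
  then obtain d where d: "d \<in> G" "e = f ` d" by blast
  then have "inj_on f d" using assms(2) by (meson Union_upper inj_on_subset)
  then show "card e = 2" using d assms(1) by (simp add: card_image simple_graph_def)
qed

lemma vertex_degree_relabel:
  assumes "inj_on f (graph_vertices G)" "v \<in> graph_vertices G"
  shows "vertex_degree (relabel f G) (f v) = vertex_degree G v"
proof -
  have "{e \<in> relabel f G. f v \<in> e} = (`) f ` {e \<in> G. v \<in> e}"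
  proof -
    have "v \<in> d" if "d \<in> G" "f v \<in> f ` d" for d
      using that assms by (metis Union_upper inj_on_image_mem_iff)
    then show ?thesis unfolding relabel_def by auto
  qed
  moreover have "inj_on ((`) f) {e \<in> G. v \<in> e}"
    by (rule inj_on_subset[OF inj_on_image_edges[OF assms(1)]]) auto
  ultimately show ?thesis by (simp add: vertex_degree_def card_image)
qed

lemma cubic_graph_relabel:
  "inj_on f (graph_vertices G) \<Longrightarrow> cubic_graph G \<Longrightarrow> cubic_graph (relabel f G)"
  unfolding cubic_graph_def graph_vertices_relabel by (auto simp: vertex_degree_relabel)

lemma connected_graph_relabel:
  assumes "connected_graph G"
  shows "connected_graph (relabel f G)"
proof -
  have "(f u, f v) \<in> {(x, y). {x, y} \<in> relabel f G}\<^sup>*"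
    if "(u, v) \<in> {(x, y). {x, y} \<in> G}\<^sup>*" for u v
    using that
  proof (induction rule: rtrancl_induct)
    case (step y z)
    then have "f ` {y, z} \<in> relabel f G"
      unfolding relabel_def by (intro imageI) simp
    then have "{f y, f z} \<in> relabel f G" by simp
    then show ?case using step.IH by (auto intro: rtrancl_into_rtrancl)
  qed auto
  then show ?thesis
    using assms unfolding connected_graph_def graph_vertices_relabel
    by (auto simp: relabel_def)
qed

lemma graph_iso_relabel:
  assumes "inj_on f (graph_vertices G)" "graph_iso (relabel f G) K"
  shows "graph_iso G K"
proof -
  obtain g where g: "bij_betw g (f ` graph_vertices G) (graph_vertices K)"
      "relabel g (relabel f G) = K"
    using assms(2) unfolding graph_iso_def graph_vertices_relabel by blast
  have "bij_betw (g \<circ> f) (graph_vertices G) (graph_vertices K)"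
    using g(1) assms(1) by (meson bij_betw_trans inj_on_imp_bij_betw)
  moreover have "relabel (g \<circ> f) G = K"
    using g(2) by (simp add: relabel_def image_image image_comp)
  ultimately show ?thesis unfolding graph_iso_def by blast
qed

lemma complete_edgesD:
  assumes "e \<in> complete_edges n"
  shows "e \<subseteq> {1..n}" "card e = 2" "finite e"
  using assms by (auto simp: complete_edges_def nsets_def)

lemma subset_complete_edges:
  assumes "F \<subseteq> complete_edges n"
  shows "simple_graph F" "graph_vertices F \<subseteq> {1..n}"
proof -
  have "finite (complete_edges n)"
    by (simp add: complete_edges_def finite_imp_finite_nsets)
  then show "simple_graph F"
    using assms finite_subset complete_edgesD(2) unfolding simple_graph_def by blast
  show "graph_vertices F \<subseteq> {1..n}"
    using assms complete_edgesD(1) by blast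
qed

lemma simple_graph_subset_complete_edges:
  "simple_graph F \<Longrightarrow> graph_vertices F \<subseteq> {1..n} \<Longrightarrow> F \<subseteq> complete_edges n"
  by (auto simp: simple_graph_def complete_edges_def nsets_def card_ge_0_finite)

section \<open>Cubic graphs and singly attached cycles\<close>

lemma cubic_card_nbrs:
  assumes "simple_graph G" "cubic_graph G" "v \<in> graph_vertices G"
  shows "card (nbrs G v) = 3"
  using assms vertex_degree_eq_card_nbrs unfolding cubic_graph_def by metis

text \<open>If all degrees in \<open>F\<close> were at least three, vertices of \<open>F\<close>
  would keep all their neighbours in \<open>G\<close>. The vertex set of \<open>F\<close> would then
  be closed under adjacency, and connectedness would give \<open>F = G\<close>.\<close>

lemma cubic_proper_subgraph:
  assumes G: "simple_graph G" "connected_graph G" "cubic_graph G"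
    and F: "F \<subseteq> G" "F \<noteq> G" "F \<noteq> {}"
  shows "\<exists>v\<in>graph_vertices F. card (nbrs F v) \<le> 2"
proof (rule ccontr)
  assume "\<not> ?thesis"
  then have ge: "card (nbrs F v) \<ge> 3" if "v \<in> graph_vertices F" for v
    using that by force
  have eq: "nbrs F v = nbrs G v" if "v \<in> graph_vertices F" for v
  proof (rule card_seteq[OF finite_nbrs[OF G(1)] nbrs_mono[OF F(1)]])
    have "v \<in> graph_vertices G" using that F(1) by blast
    then show "card (nbrs G v) \<le> card (nbrs F v)"
      using cubic_card_nbrs[OF G(1,3)] ge[OF that] by simp
  qed
  obtain e where e: "e \<in> F" using F(3) by blast
  then obtain a where a: "a \<in> e"
    using simple_graph_edge[OF G(1), of e] F(1) by blast
  have aV: "a \<in> graph_vertices F" "a \<in> graph_vertices G" using a e F(1) by blast+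
  have "graph_vertices G \<subseteq> graph_vertices F"
    using connected_graph_closed[OF G(2) aV] eq nbrs_vertices by (metis subsetI)
  moreover have "d \<in> F" if "d \<in> G" for d
  proof -
    obtain x y where d: "d = {x, y}" using simple_graph_edge[OF G(1) \<open>d \<in> G\<close>] by blast
    then have "y \<in> nbrs G x" "x \<in> graph_vertices G" using that by (auto simp: nbrs_def)
    then have "y \<in> nbrs F x" using calculation eq by blast
    then show ?thesis using d by (simp add: nbrs_def)
  qed
  ultimately show False using F by blast
qed

text \<open>Only the values of \<open>c\<close> below \<open>k\<close> count, so a list with
  \<open>(!)\<close> can serve as a cycle. The bound three rules out an edge traversed back and
  forth.\<close>

definition graph_cycle :: "'a set set \<Rightarrow> (nat \<Rightarrow> 'a) \<Rightarrow> nat \<Rightarrow> bool" where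
  "graph_cycle G c k \<longleftrightarrow> 3 \<le> k \<and> inj_on c {..<k} \<and>
     (\<forall>i. Suc i < k \<longrightarrow> {c i, c (Suc i)} \<in> G) \<and> {c (k - 1), c 0} \<in> G"

text \<open>The only neighbour of \<open>s\<close> on the cycle is placed at index 0. Any cycle can
  be rotated to this form, and the indices 1, 2, ... then give the order in which its vertices are
  removed.\<close>

definition singly_attached :: "'a set set \<Rightarrow> 'a \<Rightarrow> (nat \<Rightarrow> 'a) \<Rightarrow> nat \<Rightarrow> bool" where
  "singly_attached G s c k \<longleftrightarrow>
     s \<notin> c ` {..<k} \<and> {s, c 0} \<in> G \<and> (\<forall>i. 0 < i \<and> i < k \<longrightarrow> {s, c i} \<notin> G)"

subsection \<open>Vertices of degree at most two\<close>

locale two_rigidity =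
  fixes M :: "nat \<Rightarrow> nat set set \<Rightarrow> bool"
  assumes two_rigidity: "two_rigidity_family M"
begin

lemma symmetric: "2 \<le> n \<Longrightarrow> symmetric_graph_matroid n (M n)"
  using two_rigidity by (auto simp: two_rigidity_family_def matroidal_family_def)

lemma matroid: "2 \<le> n \<Longrightarrow> matroid (complete_edges n) (M n)"
  using symmetric by (auto simp: symmetric_graph_matroid_def)

lemma rank: "2 \<le> n \<Longrightarrow> matroid_rank (M n) = 2 * n - 3"
  using two_rigidity by (auto simp: two_rigidity_family_def)

lemma permute: "2 \<le> n \<Longrightarrow> p permutes {1..n} \<Longrightarrow> M n (relabel p X) \<longleftrightarrow> M n X"
  using symmetric by (auto simp: symmetric_graph_matroid_def)

lemma indep_subset: "2 \<le> n \<Longrightarrow> M n X \<Longrightarrow> X \<subseteq> complete_edges n"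
  using matroid by (rule matroid.indep_subset_ground)

text \<open>Combines both invariances of a family, change of size and choice of copy. The target
  size \<open>m\<close> may be smaller than \<open>n\<close>, which is what lets sets avoiding a
  vertex be compared with \<open>M (n - 1)\<close>.\<close>

lemma indep_transfer:
  assumes "2 \<le> n" "2 \<le> m" "M n X" "inj_on f (graph_vertices X)" "f ` graph_vertices X \<subseteq> {1..m}"
  shows "M m (relabel f X)"
proof -
  have X: "simple_graph X" "graph_vertices X \<subseteq> {1..n}"
    using subset_complete_edges[OF indep_subset[OF assms(1,3)]] by auto
  have "card (graph_vertices X) \<le> m"
    using card_inj_on_le[OF assms(4,5)] by simp
  moreover have "indep_copy n (M n) X"
    unfolding indep_copy_def using X assms(3) by (intro exI[of _ id]) (simp add: relabel_id_on)
  ultimately have "indep_copy m (M m) X"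
    using two_rigidity assms(1,2) X(1)
    unfolding two_rigidity_family_def matroidal_family_def by blast
  then show ?thesis
    using indep_copy_iff_all[OF symmetric[OF assms(2)] finite_graph_vertices[OF X(1)]]
      \<open>card (graph_vertices X) \<le> m\<close> assms(4,5) by blast
qed

text \<open>Exchanging \<open>v\<close> with \<open>n\<close> moves \<open>J\<close> into
  \<open>{1..n - 1}\<close>, where the rank is \<open>2 * (n - 1) - 3\<close>.\<close>

lemma card_avoiding:
  assumes "3 \<le> n" "v \<in> {1..n}" "M n J" "v \<notin> graph_vertices J"
  shows "card J \<le> 2 * n - 5"
proof -
  let ?f = "transpose v n"
  have J: "graph_vertices J \<subseteq> {1..n}"
    using subset_complete_edges(2)[OF indep_subset[of n J]] assms(1,3) by simp
  have inj: "inj_on ?f (graph_vertices J)" by (metis inj_on_subset inj_transpose subset_UNIV)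
  have "?f ` graph_vertices J \<subseteq> {1..n - 1}"
  proof
    fix y assume "y \<in> ?f ` graph_vertices J"
    then obtain x where x: "x \<in> graph_vertices J" "y = ?f x" by blast
    then have "x \<in> {1..n}" "x \<noteq> v" using J assms(4) by blast+
    then show "y \<in> {1..n - 1}"
      using x(2) assms(1,2) by (auto simp: transpose_def)
  qed
  then have "M (n - 1) (relabel ?f J)"
    using indep_transfer[of n "n - 1" J ?f] assms(1,3) inj by simp
  then have "card (relabel ?f J) \<le> 2 * (n - 1) - 3"
    using matroid.card_le_matroid_rank[OF matroid, of "n - 1"] rank[of "n - 1"] assms(1) by fastforce
  then show ?thesis using card_relabel[OF inj] by simp
qed

text \<open>The bound of \<open>card_avoiding\<close> is attained by a basis of
  \<open>M (n - 1)\<close> with \<open>v\<close> and \<open>n\<close> exchanged.\<close>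

lemma obtain_avoiding:
  assumes "3 \<le> n" "v \<in> {1..n}"
  obtains I where "M n I" "v \<notin> graph_vertices I" "card I = 2 * n - 5"
proof -
  have n: "2 \<le> n - 1" using assms(1) by simp
  obtain I where I: "M (n - 1) I" "card I = 2 * (n - 1) - 3"
    using matroid.obtain_basis[OF matroid[OF n]] rank[OF n] by metis
  let ?f = "transpose v n"
  have V: "graph_vertices I \<subseteq> {1..n - 1}"
    using subset_complete_edges(2)[OF indep_subset[OF n I(1)]] .
  have inj: "inj_on ?f (graph_vertices I)" by (metis inj_on_subset inj_transpose subset_UNIV)
  have "?f x \<in> {1..n} \<and> ?f x \<noteq> v" if "x \<in> graph_vertices I" for x
    using subsetD[OF V that] assms by (auto simp: transpose_def)
  then have *: "?f ` graph_vertices I \<subseteq> {1..n}" "v \<notin> ?f ` graph_vertices I"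
    by (metis image_subsetI, metis imageE)
  have "M n (relabel ?f I)"
    using indep_transfer[OF n _ I(1) inj *(1)] assms(1) by simp
  then show ?thesis
    using that[of "relabel ?f I"] * I(2) card_relabel[OF inj] by (simp add: graph_vertices_relabel)
qed

text \<open>Passing from \<open>n - 1\<close> to \<open>n\<close> raises the rank by two, so two of the edges at \<open>v\<close> extend
  an independent set of full rank avoiding \<open>v\<close>; by symmetry this holds for any two edges.\<close>

lemma obtain_two_edges:
  assumes n: "3 \<le> n" and v: "v \<in> {1..n}"
    and c: "c \<in> {1..n}" "d \<in> {1..n}" "c \<noteq> d" "c \<noteq> v" "d \<noteq> v"
  obtains K where "M n (K \<union> {{v, c}, {v, d}})" "v \<notin> graph_vertices K"
    "card (K \<union> {{v, c}, {v, d}}) = 2 * n - 3"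
proof -
  have n2: "2 \<le> n" using n by simp
  interpret matroid "complete_edges n" "M n" using matroid[OF n2] .
  obtain I where I: "M n I" "v \<notin> graph_vertices I" "card I = 2 * n - 5"
    using obtain_avoiding[OF n v] .
  obtain B where B: "M n B" "card B = 2 * n - 3"
    using obtain_basis rank[OF n2] by metis
  obtain W where W: "I \<subseteq> W" "M n W" "card W = 2 * n - 3"
    using augment_to_card[OF I(1) B(1)] unfolding I(3) B(2) by fastforce
  have WS: "simple_graph W" "graph_vertices W \<subseteq> {1..n}"
    using subset_complete_edges[OF indep_subset[OF n2 W(2)]] by auto
  have fin: "finite W" using indep_finite W(2) by blast
  let ?D = "W - I"
  have cD: "card ?D = 2"
    using W(1,3) I(3) fin n by (subst card_Diff_subset) (auto intro: finite_subset)
  \<comment> \<open>An added edge missing \<open>v\<close> would enlarge \<open>I\<close>, which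
    already has the greatest size possible away from \<open>v\<close>.\<close>
  have vD: "v \<in> e" if "e \<in> ?D" for e
  proof (rule ccontr)
    assume "v \<notin> e"
    moreover have "M n (insert e I)" using W(1,2) that indep_mono by blast
    ultimately have "card (insert e I) \<le> 2 * n - 5"
      using card_avoiding[OF n v] I(2) by simp
    then show False using that I(3) finite_subset[OF W(1) fin] by simp
  qed
  obtain e1 e2 where e: "?D = {e1, e2}" "e1 \<noteq> e2" using cD by (meson card_2_iff)
  obtain a where a: "e1 = {v, a}" "a \<noteq> v"
    using simple_graph_edge_at[OF WS(1), of e1 v] vD e by blast
  obtain b where b: "e2 = {v, b}" "b \<noteq> v"
    using simple_graph_edge_at[OF WS(1), of e2 v] vD e by blast
  have ab: "a \<noteq> b" "a \<in> {1..n}" "b \<in> {1..n}" 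
  proof -
    show "a \<noteq> b" using e(2) a(1) b(1) by blast
    have "{v, a} \<in> W" "{v, b} \<in> W"
      using e(1) unfolding a(1) b(1) by (metis Diff_iff insertI1, metis Diff_iff insertI1 insertI2)
    then show "a \<in> {1..n}" "b \<in> {1..n}" using WS(2) by (meson UnionI insertI1 insertI2 subsetD)+
  qed
  have W_eq: "W = I \<union> {{v, a}, {v, b}}" using e(1) W(1) unfolding a(1) b(1) by (metis Diff_partition)
  \<comment> \<open>The second transposition starts from \<open>?q b\<close> and not from
    \<open>b\<close>, because \<open>b\<close> may equal \<open>c\<close> and then has already been
    moved to \<open>a\<close>.\<close>
  let ?q = "transpose a c"
  let ?p = "transpose (?q b) d \<circ> ?q"
  have qb: "?q b \<in> {1..n}" "?q b \<noteq> c" "?q b \<noteq> v"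
    using ab b(2) c a(2) by (simp_all add: transpose_def)
  have p: "?p permutes {1..n}"
    by (intro permutes_compose permutes_swap_id qb ab c)
  have pv: "?p v = v" "?p a = c" "?p b = d"
    using qb(2,3) ab(1) a(2) c(3-5) by simp_all
  have "relabel ?p W = relabel ?p I \<union> {{v, c}, {v, d}}"
    unfolding W_eq using pv by (auto simp: relabel_def)
  moreover have "M n (relabel ?p W)" using permute[OF n2 p] W(2) by simp
  moreover have injp: "inj_on ?p X" for X
    using permutes_inj[OF p] by (rule inj_on_subset) simp
  have "card (relabel ?p W) = 2 * n - 3"
    using card_relabel[OF injp] W(3) by simp
  moreover have "v \<notin> graph_vertices (relabel ?p I)"
    unfolding graph_vertices_relabel using I(2) pv(1) permutes_inj[OF p]
    by (metis imageE inj_eq)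
  ultimately show ?thesis using that[of "relabel ?p I"] by simp
qed

text \<open>Extend the edges of \<open>F\<close> away from \<open>v\<close> to full rank, using an
  independent set whose only edges at \<open>v\<close> are \<open>{v, c}\<close> and
  \<open>{v, d}\<close>, with all neighbours of \<open>v\<close> among \<open>c\<close> and
  \<open>d\<close>. Edges away from \<open>v\<close> account for at most \<open>2 * n - 5\<close> of
  the \<open>2 * n - 3\<close>, so both edges at \<open>v\<close> must be in the extension, which
  therefore contains \<open>F\<close>.\<close>

lemma indep_add_vertex:
  assumes n: "3 \<le> n" and F: "F \<subseteq> complete_edges n"
    and deg: "vertex_degree F v \<le> 2" and v: "v \<in> graph_vertices F"
    and J: "M n {e \<in> F. v \<notin> e}"
  shows "M n F"
proof -
  have n2: "2 \<le> n" using n by simp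
  interpret matroid "complete_edges n" "M n" using matroid[OF n2] .
  have FS: "simple_graph F" "graph_vertices F \<subseteq> {1..n}"
    using subset_complete_edges[OF F] by auto
  have vn: "v \<in> {1..n}" using v FS(2) by blast
  have "nbrs F v \<subseteq> {1..n} - {v}"
    using FS not_in_nbrs_self[OF FS(1)] nbrs_vertices by fastforce
  moreover have "card (nbrs F v) \<le> 2" using deg vertex_degree_eq_card_nbrs[OF FS(1)] by simp
  moreover have "2 \<le> card ({1..n} - {v})" using n vn by simp
  \<comment> \<open>When \<open>v\<close> has fewer than two neighbours, arbitrary other vertices
    fill up the pair.\<close>
  ultimately obtain T where T: "nbrs F v \<subseteq> T" "T \<subseteq> {1..n} - {v}" "card T = 2"
    using exists_subset_between[of "nbrs F v" 2 "{1..n} - {v}"] by auto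
  then obtain c d where cd: "T = {c, d}" "c \<noteq> d" by (meson card_2_iff)
  obtain K where K: "M n (K \<union> {{v, c}, {v, d}})" "v \<notin> graph_vertices K"
    "card (K \<union> {{v, c}, {v, d}}) = 2 * n - 3"
    using obtain_two_edges[OF n vn, of c d] T(2) cd by auto
  let ?J = "{e \<in> F. v \<notin> e}"
  have "card ?J \<le> 2 * n - 5" using card_avoiding[OF n vn J] by auto
  then obtain W where W: "?J \<subseteq> W" "W \<subseteq> ?J \<union> (K \<union> {{v, c}, {v, d}})" "M n W" "card W = 2 * n - 3"
    using augment_to_card[OF J K(1)] unfolding K(3) using n by fastforce
  let ?A = "{e \<in> W. v \<notin> e}" and ?B = "{e \<in> W. v \<in> e}"
  have fin: "finite W" using indep_finite W(3) by blast
  have "M n ?A" using W(3) by (rule indep_mono) auto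
  then have "card ?A \<le> 2 * n - 5" using card_avoiding[OF n vn] by auto
  moreover have "card W = card ?A + card ?B"
    using fin by (subst card_Un_disjoint[symmetric]) (auto intro: arg_cong[where f=card])
  ultimately have "2 \<le> card ?B" using W(4) n by simp
  moreover have "?B \<subseteq> {{v, c}, {v, d}}" using W(2) K(2) by auto
  moreover have "card {{v, c}, {v, d}} = 2" using cd(2) by (simp add: doubleton_eq_iff)
  ultimately have "?B = {{v, c}, {v, d}}"
    by (intro card_seteq) auto
  moreover have "{e \<in> F. v \<in> e} \<subseteq> {{v, c}, {v, d}}"
  proof
    fix e assume e: "e \<in> {e \<in> F. v \<in> e}"
    then obtain w where w: "e = {v, w}" using simple_graph_edge_at[OF FS(1), of e v] by blast
    then have "w \<in> T" using e T(1) by (auto simp: nbrs_def)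
    then show "e \<in> {{v, c}, {v, d}}" using w cd(1) by auto
  qed
  ultimately have "F \<subseteq> W" using W(1) by blast
  then show ?thesis using W(3) indep_mono by blast
qed

text \<open>2-degeneracy is expressed through subgraphs instead of an elimination order. To verify
  it, one assumes a nonempty subgraph of minimum degree three and excludes vertices from it one by
  one.\<close>

lemma indep_of_degenerate:
  assumes n: "3 \<le> n" and "F \<subseteq> complete_edges n"
    and "\<And>F'. F' \<subseteq> F \<Longrightarrow> F' \<noteq> {} \<Longrightarrow> \<exists>v\<in>graph_vertices F'. card (nbrs F' v) \<le> 2"
  shows "M n F"
  using assms(2,3)
proof (induction "card F" arbitrary: F rule: less_induct)
  case less
  have n2: "2 \<le> n" using n by simp
  show ?case
  proof (cases "F = {}")
    case True
    then show ?thesis using matroid.indep_empty[OF matroid[OF n2]] by simp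
  next
    case False
    then obtain v where v: "v \<in> graph_vertices F" "card (nbrs F v) \<le> 2"
      using less.prems(2)[of F] by auto
    have FS: "simple_graph F" using subset_complete_edges less.prems(1) by blast
    let ?J = "{e \<in> F. v \<notin> e}"
    have "card ?J < card F"
      using v(1) FS by (intro psubset_card_mono) (auto simp: simple_graph_def)
    then have "M n ?J"
    proof (rule less.hyps)
      show "?J \<subseteq> complete_edges n" using less.prems(1) by blast
      show "\<exists>v\<in>graph_vertices F'. card (nbrs F' v) \<le> 2" if "F' \<subseteq> ?J" "F' \<noteq> {}" for F'
        using that by (intro less.prems(2)) auto
    qed
    then show ?thesis
      using indep_add_vertex[OF n less.prems(1) _ v(1)] v(2) vertex_degree_eq_card_nbrs[OF FS]
      by simp
  qed
qed

text \<open>Let \<open>G'\<close> be the copy of \<open>G\<close> in which \<open>s\<close> is replaced by a new vertex \<open>n\<close>. After the removal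
  of the edge from \<open>c 0\<close> to \<open>c 1\<close>, the vertices \<open>c 1, c 2, \<dots>\<close>, then \<open>c 0\<close>, then \<open>s\<close> and \<open>n\<close> can be
  stripped from \<open>G \<union> G'\<close> one after the other, each having degree at most two at its turn.\<close>

lemma indep_of_singly_attached:
  assumes m: "2 \<le> m" and G: "simple_graph G" "connected_graph G" "cubic_graph G"
    and V: "graph_vertices G \<subseteq> {1..m}"
    and cyc: "graph_cycle G c k" and att: "singly_attached G s c k"
  shows "M (Suc m) G"
proof (rule ccontr)
  assume dep: "\<not> M (Suc m) G"
  let ?n = "Suc m"
  let ?t = "transpose s ?n"
  let ?G' = "relabel ?t G"
  have n: "3 \<le> ?n" "2 \<le> ?n" using m by auto
  interpret matroid "complete_edges ?n" "M ?n" using matroid[OF n(2)] .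
  have nV: "?n \<notin> graph_vertices G" using V by (auto simp del: Union_iff)
  have c: "3 \<le> k" "inj_on c {..<k}" "\<And>i. Suc i < k \<Longrightarrow> {c i, c (Suc i)} \<in> G" "{c (k - 1), c 0} \<in> G"
    using cyc by (auto simp: graph_cycle_def)
  have s: "\<And>i. i < k \<Longrightarrow> s \<noteq> c i" "{s, c 0} \<in> G" "\<And>i. 0 < i \<Longrightarrow> i < k \<Longrightarrow> {s, c i} \<notin> G"
    using att by (auto simp: singly_attached_def)
  have sV: "s \<in> graph_vertices G" using s(2) by blast
  have cV: "c i \<in> graph_vertices G" if "i < k" for i
  proof (cases i)
    case 0
    then show ?thesis using s(2) by blast
  next
    case (Suc j)
    then have "{c j, c i} \<in> G" using c(3)[of j] that by simp
    then show ?thesis by blast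
  qed
  have sn: "s \<noteq> ?n" using sV nV by metis
  have cn: "c i \<noteq> ?n" if "i < k" for i using cV[OF that] nV by metis
  have nbrsG_n: "?n \<notin> nbrs G y" "nbrs G ?n = {}" for y
    using nV nbrs_vertices[of _ G] by blast+
  \<comment> \<open>\<open>?t\<close> is an involution, so adjacency in \<open>?G'\<close> can be
    read off in \<open>G\<close>: \<open>?n\<close> takes over the neighbours of \<open>s\<close>,
    and \<open>s\<close> keeps none.\<close>
  have edge_G': "{x, y} \<in> ?G' \<longleftrightarrow> {?t x, ?t y} \<in> G" for x y
  proof
    assume "{x, y} \<in> ?G'"
    then obtain d where d: "d \<in> G" "{x, y} = ?t ` d" by (auto simp: relabel_def)
    then have "?t ` {x, y} = d" by (simp add: image_image)
    then show "{?t x, ?t y} \<in> G" using d(1) by simp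
  next
    assume "{?t x, ?t y} \<in> G"
    then have "?t ` {?t x, ?t y} \<in> ?G'" unfolding relabel_def by (rule imageI)
    then show "{x, y} \<in> ?G'" by simp
  qed
  have nbrs_G': "w \<in> nbrs ?G' y \<longleftrightarrow> ?t w \<in> nbrs G (?t y)" for w y
    unfolding nbrs_def using edge_G' by simp
  have G'_s: "nbrs ?G' s = {}"
    using nbrs_G' nbrsG_n(2) by (auto simp: transpose_def)
  have G'_n: "nbrs ?G' ?n \<subseteq> nbrs G s"
  proof
    fix w assume "w \<in> nbrs ?G' ?n"
    then have "?t w \<in> nbrs G s" using nbrs_G' by simp
    then show "w \<in> nbrs G s"
      using nbrsG_n not_in_nbrs_self[OF G(1), of s] by (auto simp: transpose_def split: if_splits)
  qed
  have G'_y: "nbrs ?G' y \<subseteq> insert ?n (nbrs G y)" if "y \<noteq> s" "y \<noteq> ?n" for y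
  proof
    fix w assume "w \<in> nbrs ?G' y"
    then have "?t w \<in> nbrs G y" using nbrs_G' that by simp
    then show "w \<in> insert ?n (nbrs G y)"
      using nbrsG_n by (auto simp: transpose_def split: if_splits)
  qed
  have G'_n_mem: "?n \<in> nbrs ?G' y \<Longrightarrow> s \<in> nbrs G y" if "y \<noteq> s" "y \<noteq> ?n" for y
    using nbrs_G'[of ?n y] that by simp

  have not_G': "{s, c 0} \<notin> ?G'"
    using G'_s by (auto simp: nbrs_def)
  \<comment> \<open>Elimination needs an independent intersection. The edge from \<open>s\<close> to
    \<open>c 0\<close> is missing from \<open>?G'\<close>, so the intersection is a proper subgraph
    of \<open>G\<close>.\<close>
  have "M ?n (G \<inter> ?G')"
  proof (rule indep_of_degenerate[OF n(1)])
    have "graph_vertices G \<subseteq> {1..?n}" using V by fastforce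
    then have "G \<subseteq> complete_edges ?n" by (rule simple_graph_subset_complete_edges[OF G(1)])
    then show "G \<inter> ?G' \<subseteq> complete_edges ?n" by blast
    fix F assume F: "F \<subseteq> G \<inter> ?G'" "F \<noteq> {}"
    have "F \<subseteq> G" "F \<noteq> G" using F(1) s(2) not_G' by blast+
    then show "\<exists>v\<in>graph_vertices F. card (nbrs F v) \<le> 2"
      using cubic_proper_subgraph[OF G] F(2) by metis
  qed
  moreover have perm: "?t permutes {1..?n}"
    using sV V by (intro permutes_swap_id) auto
  then have dep': "\<not> M ?n ?G'" using permute[OF n(2)] dep by simp
  moreover have neq: "G \<noteq> ?G'" using s(2) not_G' by metis
  moreover have e: "{c 0, c 1} \<in> G" using c(1) c(3)[of 0] by simp
  ultimately have "\<not> M ?n (G \<union> ?G' - {{c 0, c 1}})"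
    using dependent_Un_minus[OF dep dep' _ neq] by (metis UnI1)
  moreover have "M ?n (G \<union> ?G' - {{c 0, c 1}})"
  proof (rule indep_of_degenerate[OF n(1)])
    have "graph_vertices G \<subseteq> {1..?n}" using V by fastforce
    moreover have "graph_vertices ?G' \<subseteq> {1..?n}"
      unfolding graph_vertices_relabel using calculation permutes_image[OF perm] by (metis image_mono)
    moreover have "simple_graph ?G'"
      using G(1) by (rule simple_graph_relabel) (metis inj_on_subset inj_transpose subset_UNIV)
    ultimately show "G \<union> ?G' - {{c 0, c 1}} \<subseteq> complete_edges ?n"
      using simple_graph_subset_complete_edges G(1) by (metis Diff_subset Un_least subset_trans)
    fix F assume F: "F \<subseteq> G \<union> ?G' - {{c 0, c 1}}" "F \<noteq> {}"
    show "\<exists>v\<in>graph_vertices F. card (nbrs F v) \<le> 2"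
    proof (rule ccontr)
      assume "\<not> ?thesis"
      \<comment> \<open>From here \<open>F\<close> has minimum degree at least three, and stripping
        a vertex means showing that it cannot belong to \<open>F\<close>.\<close>
      then have core: "v \<notin> graph_vertices F" if "card (nbrs F v) \<le> 2" for v
        using that by blast
      have nbrs_F: "nbrs F y \<subseteq> nbrs G y \<union> nbrs ?G' y" for y
        using F(1) by (auto simp: nbrs_def)
      \<comment> \<open>Separate \<open>u\<close> and \<open>v\<close> are needed for
        \<open>?n\<close>, whose neighbours are bounded by those of \<open>s\<close>; in all other
        uses they coincide.\<close>
      have out: "v \<notin> graph_vertices F" if "nbrs F v \<subseteq> nbrs G u - {x}" "x \<in> nbrs G u" for u v x
      proof (rule core)
        have "u \<in> graph_vertices G" using that(2) nbrs_vertices by metis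
        then have "card (nbrs G u - {x}) = 2"
          using cubic_card_nbrs[OF G(1,3)] that(2) by simp
        then show "card (nbrs F v) \<le> 2"
          using card_mono[OF _ that(1)] finite_nbrs[OF G(1)] by simp
      qed
      \<comment> \<open>Each of these vertices has lost a neighbour: \<open>c 1\<close> through the
        deleted edge, every later one through its predecessor. It does not gain \<open>?n\<close> in
        exchange, since it is not adjacent to \<open>s\<close>.\<close>
      have out_c: "c (Suc i) \<notin> graph_vertices F" if "Suc i < k" for i
        using that
      proof (induction i)
        case 0
        have "c 0 \<notin> nbrs F (c 1)" using F(1) by (auto simp: nbrs_def insert_commute)
        moreover have "?n \<notin> nbrs ?G' (c 1)"
          using G'_n_mem[of "c 1"] s(1)[of 1] s(3)[of 1] cn[of 1] c(1) by (auto simp: nbrs_def insert_commute)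
        ultimately have "nbrs F (c 1) \<subseteq> nbrs G (c 1) - {c 0}"
          using nbrs_F[of "c 1"] G'_y[of "c 1"] s(1)[of 1] cn[of 1] c(1) by auto
        then show ?case using out[of "c 1" "c 1" "c 0"] e by (simp add: nbrs_def insert_commute)
      next
        case (Suc i)
        let ?y = "c (Suc (Suc i))"
        have "c (Suc i) \<notin> graph_vertices F" using Suc.IH Suc.prems Suc_lessD by blast
        then have "c (Suc i) \<notin> nbrs F ?y" using nbrs_vertices by metis
        moreover have "?n \<notin> nbrs ?G' ?y"
          using G'_n_mem[of ?y] s(1)[of "Suc (Suc i)"] s(3)[of "Suc (Suc i)"] cn[of "Suc (Suc i)"] Suc.prems
          by (auto simp: nbrs_def insert_commute)
        ultimately have "nbrs F ?y \<subseteq> nbrs G ?y - {c (Suc i)}"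
          using nbrs_F[of ?y] G'_y[of ?y] s(1)[of "Suc (Suc i)"] cn[of "Suc (Suc i)"] Suc.prems by auto
        then show ?case
          using out[of ?y ?y "c (Suc i)"] c(3)[OF Suc.prems] by (simp add: nbrs_def insert_commute)
      qed
      have c0: "c 0 \<notin> graph_vertices F"
      proof (rule core)
        have "c 1 \<notin> graph_vertices F" "c (k - 1) \<notin> graph_vertices F"
          using out_c[of 0] out_c[of "k - 2"] c(1) by (simp_all add: Suc_diff_Suc numeral_2_eq_2)
        then have "c 1 \<notin> nbrs F (c 0)" "c (k - 1) \<notin> nbrs F (c 0)"
          using nbrs_vertices by metis+
        then have "nbrs F (c 0) \<subseteq> insert ?n (nbrs G (c 0)) - {c 1, c (k - 1)}"
          using nbrs_F[of "c 0"] G'_y[of "c 0"] s(1)[of 0] cn[of 0] c(1) by auto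
        \<comment> \<open>Four possible neighbours including \<open>?n\<close>, less the two on the
          cycle, which are distinct because \<open>3 \<le> k\<close>.\<close>
        moreover have "card (insert ?n (nbrs G (c 0)) - {c 1, c (k - 1)}) = 2"
        proof -
          have "{c 1, c (k - 1)} \<subseteq> insert ?n (nbrs G (c 0))"
            using e c(4) by (auto simp: nbrs_def insert_commute)
          moreover have "c 1 \<noteq> c (k - 1)" using inj_onD[OF c(2), of 1 "k - 1"] c(1) by auto
          moreover have "card (insert ?n (nbrs G (c 0))) = 4"
            using cubic_card_nbrs[OF G(1,3) cV[of 0]] nbrsG_n(1) finite_nbrs[OF G(1)] c(1) by simp
          ultimately show ?thesis by (subst card_Diff_subset) auto
        qed
        ultimately show "card (nbrs F (c 0)) \<le> 2"
          using card_mono finite_nbrs[OF G(1)] by (metis finite_Diff finite_insert)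
      qed
      then have c0': "c 0 \<notin> nbrs F y" for y using nbrs_vertices by metis
      have c0s: "c 0 \<in> nbrs G s" using s(2) by (simp add: nbrs_def)
      have "s \<notin> graph_vertices F" "?n \<notin> graph_vertices F"
      proof -
        have "nbrs F s \<subseteq> nbrs G s - {c 0}" using nbrs_F[of s] G'_s c0'[of s] by blast
        then show "s \<notin> graph_vertices F" by (rule out[OF _ c0s])
        have "nbrs F ?n \<subseteq> nbrs G s - {c 0}" using nbrs_F[of ?n] G'_n nbrsG_n(2) c0'[of ?n] by blast
        then show "?n \<notin> graph_vertices F" by (rule out[OF _ c0s])
      qed
      \<comment> \<open>Edges avoiding both \<open>s\<close> and \<open>?n\<close> are fixed by
        \<open>?t\<close>, so the two copies agree on all that is left.\<close>
      have "F \<subseteq> G"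
      proof
        fix f assume f: "f \<in> F"
        show "f \<in> G"
        proof (cases "f \<in> G")
          case False
          then have "f \<in> ?G'" using f F(1) by blast
          moreover have "s \<notin> f" "?n \<notin> f"
            using f \<open>s \<notin> graph_vertices F\<close> \<open>?n \<notin> graph_vertices F\<close> by blast+
          moreover obtain d where d: "d \<in> G" "f = ?t ` d" using calculation(1) by (auto simp: relabel_def)
          then have "?t ` f = d" by (simp add: image_image)
          moreover have "?t ` f = f"
            using \<open>s \<notin> f\<close> \<open>?n \<notin> f\<close> by (force simp: transpose_def image_iff)
          ultimately show ?thesis using d(1) by simp
        qed
      qed
      moreover have "F \<noteq> G" using c0 cV[of 0] c(1) by force
      ultimately show False
        using cubic_proper_subgraph[OF G _ _ F(2)] core by metis
    qed
  qed
  ultimately show False by blast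
qed

end

subsection \<open>Cycles in cubic graphs\<close>

text \<open>On a longest path all neighbours of the last vertex lie on the path. It has three of
  them, so one is not its predecessor and closes a cycle.\<close>

lemma exists_graph_cycle:
  assumes G: "simple_graph G" "cubic_graph G" "graph_vertices G \<noteq> {}"
  shows "\<exists>c k. graph_cycle G c k"
proof -
  define path where "path m \<longleftrightarrow> (\<exists>c. inj_on c {..m} \<and> c ` {..m} \<subseteq> graph_vertices G \<and>
    (\<forall>i<m. {c i, c (Suc i)} \<in> G))" for m :: nat
  obtain v where "v \<in> graph_vertices G" using G(3) by blast
  then have "path 0" unfolding path_def by (intro exI[of _ "\<lambda>_. v"]) simp
  moreover have "m \<le> card (graph_vertices G)" if "path m" for m
  proof -
    obtain c where "inj_on c {..m}" "c ` {..m} \<subseteq> graph_vertices G"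
      using \<open>path m\<close> unfolding path_def by blast
    then have "card {..m} \<le> card (graph_vertices G)"
      using card_inj_on_le finite_graph_vertices[OF G(1)] by metis
    then show ?thesis by simp
  qed
  ultimately obtain m where m: "path m" "\<And>m'. path m' \<Longrightarrow> m' \<le> m"
    using Nat.ex_has_greatest_nat[of path 0 "card (graph_vertices G)"] by blast
  obtain c where c: "inj_on c {..m}" "c ` {..m} \<subseteq> graph_vertices G"
    "\<And>i. i < m \<Longrightarrow> {c i, c (Suc i)} \<in> G"
    using m(1) unfolding path_def by blast
  have on_path: "w \<in> c ` {..<m}" if w: "w \<in> nbrs G (c m)" for w
  proof (rule ccontr)
    assume "w \<notin> c ` {..<m}"
    moreover have "w \<noteq> c m" using w not_in_nbrs_self[OF G(1)] by metis
    ultimately have new: "w \<notin> c ` {..m}" by (auto simp: le_less)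
    let ?d = "c(Suc m := w)"
    have "inj_on ?d {..Suc m}"
      using c(1) new by (auto simp: atMost_Suc inj_on_def)
    moreover have "?d ` {..Suc m} \<subseteq> graph_vertices G"
      using c(2) nbrs_vertices[OF w] by (auto simp: atMost_Suc)
    moreover have "{?d i, ?d (Suc i)} \<in> G" if "i < Suc m" for i
      using that c(3)[of i] w by (auto simp: less_Suc_eq nbrs_def)
    ultimately have "path (Suc m)" unfolding path_def by blast
    then show False using m(2) by fastforce
  qed
  have "c m \<in> graph_vertices G" using c(2) by blast
  then have "card (nbrs G (c m)) = 3" by (rule cubic_card_nbrs[OF G(1,2)])
  \<comment> \<open>For \<open>m = 0\<close> truncated subtraction turns \<open>c (m - 1)\<close>
    into \<open>c 0\<close>; this case dies when \<open>on_path\<close> yields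
    \<open>j < m\<close>.\<close>
  then have "\<not> nbrs G (c m) \<subseteq> {c (m - 1)}"
    using card_mono[of "{c (m - 1)}" "nbrs G (c m)"] by fastforce
  then obtain w where w: "w \<in> nbrs G (c m)" "w \<noteq> c (m - 1)" by blast
  then obtain j where j: "j < m" "w = c j" using on_path by blast
  then have "j \<noteq> m - 1" using w(2) by blast
  then have j2: "j + 2 \<le> m" using j(1) by linarith
  have "graph_cycle G (\<lambda>i. c (j + i)) (m - j + 1)"
    unfolding graph_cycle_def
  proof (intro conjI allI impI)
    show "3 \<le> m - j + 1" using j2 by simp
    show "inj_on (\<lambda>i. c (j + i)) {..<m - j + 1}"
      using c(1) j(1) by (auto intro!: inj_onI dest: inj_onD)
    show "{c (j + i), c (j + Suc i)} \<in> G" if "Suc i < m - j + 1" for i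
      using c(3)[of "j + i"] that by simp
    show "{c (j + (m - j + 1 - 1)), c (j + 0)} \<in> G"
      using w(1) j by (simp add: nbrs_def)
  qed
  then show ?thesis by blast
qed

lemma graph_cycle_arc:
  assumes c: "graph_cycle G c k" and s: "s \<notin> c ` {..<k}"
    and j: "a < b" "b < k" "{s, c a} \<in> G" "{s, c b} \<in> G"
  shows "graph_cycle G (\<lambda>i. if i = 0 then s else c (a + i - 1)) (b - a + 2)"
  unfolding graph_cycle_def
proof (intro conjI allI impI)
  show "3 \<le> b - a + 2" using j(1) by simp
  have inj: "inj_on c {..<k}" using c by (simp add: graph_cycle_def)
  show "inj_on (\<lambda>i. if i = 0 then s else c (a + i - 1)) {..<b - a + 2}"
  proof (rule inj_onI)
    fix x y
    assume xy: "x \<in> {..<b - a + 2}" "y \<in> {..<b - a + 2}"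
      "(if x = 0 then s else c (a + x - 1)) = (if y = 0 then s else c (a + y - 1))"
    have idx: "a + x - 1 < k" "a + y - 1 < k" using xy(1,2) j(1,2) by auto
    show "x = y"
    proof (cases "x = 0 \<or> y = 0")
      case True
      then show ?thesis using xy(3) s idx by (auto split: if_splits)
    next
      case False
      then have "a + x - 1 = a + y - 1"
        using xy(3) idx inj_onD[OF inj, of "a + x - 1" "a + y - 1"] by auto
      then show ?thesis using False by linarith
    qed
  qed
  show "{if i = 0 then s else c (a + i - 1), if Suc i = 0 then s else c (a + Suc i - 1)} \<in> G"
    if "Suc i < b - a + 2" for i
  proof (cases i)
    case (Suc l)
    then have "Suc (a + l) < k" using that j(1,2) by simp
    then show ?thesis using c Suc by (simp add: graph_cycle_def)
  qed (use j in simp)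
  show "{if b - a + 2 - 1 = 0 then s else c (a + (b - a + 2 - 1) - 1), if 0 = 0 then s else c (a + 0 - 1)} \<in> G"
    using j by (simp add: insert_commute)
qed

text \<open>The complementary way round: from \<open>s\<close> to \<open>c b\<close>, forward to
  \<open>c (k - 1)\<close>, across the closing edge to \<open>c 0\<close>, and back. The last index
  \<open>k - b + 1\<close> is the one carrying \<open>c 0\<close>.\<close>

lemma graph_cycle_other_arc:
  assumes c: "graph_cycle G c k" and s: "s \<notin> c ` {..<k}"
    and j: "0 < b" "b < k" "{s, c 0} \<in> G" "{s, c b} \<in> G"
  shows "graph_cycle G (\<lambda>i. if i = 0 then s else if i \<le> k - b then c (b + i - 1) else c 0) (k - b + 2)"
    (is "graph_cycle G ?d _")
  unfolding graph_cycle_def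
proof (intro conjI allI impI)
  have ck: "inj_on c {..<k}" "{c (k - 1), c 0} \<in> G"
    using c by (simp_all add: graph_cycle_def)
  show "3 \<le> k - b + 2" using j(2) by simp
  show "inj_on ?d {..<k - b + 2}"
  proof (rule inj_onI)
    fix x y assume xy: "x \<in> {..<k - b + 2}" "y \<in> {..<k - b + 2}" "?d x = ?d y"
    define idx where "idx i = (if i \<le> k - b then b + i - 1 else 0)" for i
    have d: "?d i = (if i = 0 then s else c (idx i))" for i by (simp add: idx_def)
    have idx: "idx i < k" if "i \<noteq> 0" for i using that j(1,2) by (auto simp: idx_def)
    show "x = y"
    proof (cases "x = 0 \<or> y = 0")
      case True
      then show ?thesis using xy(3) s idx unfolding d by (auto split: if_splits)
    next
      case False
      then have "idx x = idx y"
        using xy(3) idx inj_onD[OF ck(1), of "idx x" "idx y"] unfolding d by auto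
      then show ?thesis using False xy(1,2) j(1,2) by (auto simp: idx_def split: if_splits)
    qed
  qed
  show "{?d i, ?d (Suc i)} \<in> G" if i: "Suc i < k - b + 2" for i
  proof -
    consider "i = 0" | "0 < i" "i < k - b" | "i = k - b" using i by linarith
    then show ?thesis
    proof cases
      case 1
      then show ?thesis using j by simp
    next
      case 2
      then obtain l where l: "i = Suc l" by (cases i) auto
      then have "Suc (b + l) < k" using 2 by simp
      then show ?thesis using 2 c l by (simp add: graph_cycle_def)
    next
      case 3
      then show ?thesis using ck(2) j(1,2) by simp
    qed
  qed
  show "{?d (k - b + 2 - 1), ?d 0} \<in> G" using j(2,3) by (simp add: insert_commute)
qed

lemma graph_cycle_chord:
  assumes c: "graph_cycle G c k" and j: "2 \<le> j" "j < k" "{c 0, c j} \<in> G"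
  shows "graph_cycle G c (Suc j)"
  using assms unfolding graph_cycle_def by (auto simp: insert_commute intro: inj_on_subset)

text \<open>Take for \<open>s\<close> the third neighbour of \<open>c 0\<close>. It is off the
  cycle, as a chord would give a shorter one. A second neighbour on the cycle would create two
  cycles through \<open>s\<close> of total length \<open>k + 4\<close>, while minimality demands at
  least \<open>2 * k\<close>; this is where \<open>5 \<le> k\<close> enters.\<close>

lemma exists_singly_attached_long:
  assumes G: "simple_graph G" "cubic_graph G"
    and c: "graph_cycle G c k" and k: "5 \<le> k"
    and min: "\<And>c' k'. graph_cycle G c' k' \<Longrightarrow> k \<le> k'"
  shows "\<exists>s. singly_attached G s c k"
proof -
  have c1: "{c 0, c 1} \<in> G" and ck: "{c (k - 1), c 0} \<in> G" and inj: "inj_on c {..<k}"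
    using c k by (auto simp: graph_cycle_def)
  have "c 0 \<in> graph_vertices G" using c1 by blast
  then have "card (nbrs G (c 0)) = 3" by (rule cubic_card_nbrs[OF G])
  moreover have "card {c 1, c (k - 1)} \<le> 2" by (simp add: card_insert_if)
  ultimately have "\<not> nbrs G (c 0) \<subseteq> {c 1, c (k - 1)}"
    using card_mono[of "{c 1, c (k - 1)}" "nbrs G (c 0)"] by fastforce
  then obtain s where s: "s \<in> nbrs G (c 0)" "s \<noteq> c 1" "s \<noteq> c (k - 1)" by blast
  have sc: "{s, c 0} \<in> G" using s(1) by (simp add: nbrs_def insert_commute)
  have off: "s \<noteq> c j" if "j < k" for j
  proof
    assume sj: "s = c j"
    have "j \<noteq> 0" using s(1) sj not_in_nbrs_self[OF G(1)] by metis
    moreover have "j \<noteq> 1" "j \<noteq> k - 1" using s sj by auto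
    ultimately have "2 \<le> j" "Suc j < k" using that by linarith+
    then have "graph_cycle G c (Suc j)"
      using graph_cycle_chord[OF c, of j] s(1) sj by (simp add: nbrs_def)
    then show False using min \<open>Suc j < k\<close> by fastforce
  qed
  then have s_notin: "s \<notin> c ` {..<k}" by blast
  have "{s, c j} \<notin> G" if "0 < j" "j < k" for j
  proof
    assume sj: "{s, c j} \<in> G"
    have "k \<le> j - 0 + 2"
      using min graph_cycle_arc[OF c s_notin that sc sj] by blast
    moreover have "k \<le> k - j + 2"
      using min graph_cycle_other_arc[OF c s_notin that sc sj] by blast
    ultimately show False using k that by linarith
  qed
  then show ?thesis unfolding singly_attached_def using s_notin sc by blast
qed

section \<open>Recognising complete and complete bipartite graphs by their neighbourhoods\<close>

lemma graph_iso_complete: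
  assumes G: "simple_graph G" and n: "card (graph_vertices G) = n" "2 \<le> n"
    and nb: "\<And>v. v \<in> graph_vertices G \<Longrightarrow> nbrs G v = graph_vertices G - {v}"
  shows "graph_iso G (complete_edges n)"
proof -
  let ?V = "graph_vertices G"
  obtain f where f: "bij_betw f ?V {1..n}"
    using finite_same_card_bij[OF finite_graph_vertices[OF G], of "{1..n}"] n(1) by auto
  have inj: "inj_on f ?V" and im: "f ` ?V = {1..n}" using f by (auto simp: bij_betw_def)
  have rel: "relabel f G = complete_edges n"
  proof
    show "relabel f G \<subseteq> complete_edges n"
      by (intro simple_graph_subset_complete_edges simple_graph_relabel G inj)
        (simp add: graph_vertices_relabel im)
    show "complete_edges n \<subseteq> relabel f G"
    proof
      fix e assume e: "e \<in> complete_edges n"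
      then obtain x y where xy: "e = {x, y}" "x \<noteq> y"
        using complete_edgesD(2) by (meson card_2_iff)
      then have "x \<in> f ` ?V" "y \<in> f ` ?V" using complete_edgesD(1)[OF e] im by auto
      then obtain u v where uv: "u \<in> ?V" "x = f u" "v \<in> ?V" "y = f v" by blast
      then have "v \<in> nbrs G u" using nb xy(2) by blast
      then have "f ` {u, v} \<in> relabel f G" unfolding relabel_def nbrs_def by blast
      then show "e \<in> relabel f G" using xy uv by simp
    qed
  qed
  then have "graph_vertices (complete_edges n) = {1..n}"
    using graph_vertices_relabel[of f G] im by simp
  then show ?thesis unfolding graph_iso_def using f rel by auto
qed

lemma graph_iso_complete_bipartite:
  assumes G: "simple_graph G" and V: "graph_vertices G = A \<union> B" "A \<inter> B = {}"
    and card: "card A = m" "card B = n"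
    and nb: "\<And>v. v \<in> A \<Longrightarrow> nbrs G v = B" "\<And>v. v \<in> B \<Longrightarrow> nbrs G v = A"
  shows "graph_iso G (complete_bipartite_edges m n)"
proof -
  have fin: "finite A" "finite B" using finite_graph_vertices[OF G] V(1) by auto
  obtain g where g: "bij_betw g A {1..m}"
    using finite_same_card_bij[OF fin(1), of "{1..m}"] card(1) by auto
  obtain h where h: "bij_betw h B {m+1..m+n}"
    using finite_same_card_bij[OF fin(2), of "{m+1..m+n}"] card(2) by auto
  define f where "f v = (if v \<in> A then g v else h v)" for v
  have fA: "bij_betw f A {1..m}"
    using g by (rule bij_betw_cong[THEN iffD1, rotated]) (simp add: f_def)
  have fB: "bij_betw f B {m+1..m+n}"
    using h by (rule bij_betw_cong[THEN iffD1, rotated]) (use V(2) in \<open>auto simp: f_def\<close>)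
  have f: "bij_betw f (graph_vertices G) ({1..m} \<union> {m+1..m+n})"
    unfolding V(1) using fA fB by (rule bij_betw_combine) auto
  have G_eq: "G = {{a, b} | a b. a \<in> A \<and> b \<in> B}"
  proof (intro equalityI subsetI)
    fix e assume e: "e \<in> G"
    then obtain x y where xy: "e = {x, y}" using simple_graph_edge[OF G] by metis
    then have "x \<in> A \<union> B" using e V(1) by blast
    then consider "x \<in> A" | "x \<in> B" by blast
    then show "e \<in> {{a, b} | a b. a \<in> A \<and> b \<in> B}"
    proof cases
      case 1
      then have "y \<in> B" using nb(1) xy e by (auto simp: nbrs_def)
      then show ?thesis using 1 xy by blast
    next
      case 2
      then have "y \<in> A" using nb(2) xy e by (auto simp: nbrs_def)
      then show ?thesis using 2 xy insert_commute by blast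
    qed
  next
    fix e assume "e \<in> {{a, b} | a b. a \<in> A \<and> b \<in> B}"
    then obtain a b where "e = {a, b}" "a \<in> A" "b \<in> B" by blast
    then show "e \<in> G" using nb(1) by (auto simp: nbrs_def)
  qed
  have imA: "f ` A = {1..m}" and imB: "f ` B = {m+1..m+n}"
    using fA fB by (auto simp: bij_betw_def)
  have rel: "relabel f G = complete_bipartite_edges m n"
    unfolding complete_bipartite_edges_def imA[symmetric] imB[symmetric] relabel_def
  proof (subst G_eq, intro equalityI subsetI)
    fix e assume "e \<in> (`) f ` {{a, b} | a b. a \<in> A \<and> b \<in> B}"
    then obtain a b where "e = {f a, f b}" "a \<in> A" "b \<in> B" by auto
    then show "e \<in> {{a, b} | a b. a \<in> f ` A \<and> b \<in> f ` B}" by blast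
  next
    fix e assume "e \<in> {{a, b} | a b. a \<in> f ` A \<and> b \<in> f ` B}"
    then obtain a b where "e = f ` {a, b}" "a \<in> A" "b \<in> B" by auto
    then show "e \<in> (`) f ` {{a, b} | a b. a \<in> A \<and> b \<in> B}" by blast
  qed
  then have "graph_vertices (complete_bipartite_edges m n) = {1..m} \<union> {m+1..m+n}"
    using graph_vertices_relabel[of f G] f by (simp add: bij_betw_def)
  then show ?thesis unfolding graph_iso_def using f rel by auto
qed

section \<open>Classification of cubic graphs without a singly attached cycle\<close>

locale no_singly_attached =
  fixes G :: "'a set set"
  assumes simple: "simple_graph G" and connected: "connected_graph G" and cubic: "cubic_graph G"
    and no_attached: "graph_cycle G c k \<Longrightarrow> \<not> singly_attached G s c k"
begin

lemma edge_neq: "{x, y} \<in> G \<Longrightarrow> x \<noteq> y"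
  using simple by (auto simp: simple_graph_def)

lemma nbrs_eqI:
  assumes "{x, y, z} \<subseteq> nbrs G v" "x \<noteq> y" "x \<noteq> z" "y \<noteq> z"
  shows "nbrs G v = {x, y, z}"
proof -
  have "v \<in> graph_vertices G" using assms(1) nbrs_vertices[of x G v] by blast
  then have "card (nbrs G v) = 3" by (rule cubic_card_nbrs[OF simple cubic])
  then show ?thesis
    using assms by (intro card_seteq[symmetric] finite_nbrs[OF simple]) auto
qed

lemma third_nbr:
  assumes "{v, x} \<in> G" "{v, y} \<in> G" "x \<noteq> y"
  obtains z where "z \<noteq> x" "z \<noteq> y" "nbrs G v = {x, y, z}" "{v, z} \<in> G"
proof -
  have "v \<in> graph_vertices G" using assms(1) by blast
  then have "card (nbrs G v) = 3" by (rule cubic_card_nbrs[OF simple cubic])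
  moreover have sub: "{x, y} \<subseteq> nbrs G v" using assms by (simp add: nbrs_def)
  ultimately have "card (nbrs G v - {x, y}) = 1"
    using assms(3) by (subst card_Diff_subset) auto
  then obtain z where z: "nbrs G v - {x, y} = {z}" by (auto simp: card_1_singleton_iff)
  then have "nbrs G v = {x, y, z}" "z \<noteq> x" "z \<noteq> y" using sub by blast+
  then show ?thesis using that by (auto simp: nbrs_def)
qed

lemma second_nbr_triangle:
  assumes "{a, b} \<in> G" "{b, c} \<in> G" "{c, a} \<in> G" "{s, a} \<in> G" "s \<noteq> b" "s \<noteq> c"
  shows "{s, b} \<in> G \<or> {s, c} \<in> G"
proof (rule ccontr)
  assume *: "\<not> ?thesis"
  have "a \<noteq> b" "b \<noteq> c" "c \<noteq> a" "s \<noteq> a" using assms edge_neq by blast+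
  then have "graph_cycle G ((!) [a, b, c]) 3"
    using assms by (auto simp: graph_cycle_def inj_on_def less_Suc_eq numeral_3_eq_3)
  moreover have "singly_attached G s ((!) [a, b, c]) 3"
    using assms * \<open>s \<noteq> a\<close> by (auto simp: singly_attached_def less_Suc_eq numeral_3_eq_3)
  ultimately show False using no_attached by blast
qed

lemma second_nbr_square:
  assumes "{a, b} \<in> G" "{b, c} \<in> G" "{c, d} \<in> G" "{d, a} \<in> G" "a \<noteq> c" "b \<noteq> d"
    "{s, a} \<in> G" "s \<noteq> b" "s \<noteq> c" "s \<noteq> d"
  shows "{s, b} \<in> G \<or> {s, c} \<in> G \<or> {s, d} \<in> G"
proof (rule ccontr)
  assume *: "\<not> ?thesis"
  have "a \<noteq> b" "b \<noteq> c" "c \<noteq> d" "d \<noteq> a" "s \<noteq> a" using assms edge_neq by blast+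
  then have "graph_cycle G ((!) [a, b, c, d]) 4"
    using assms by (auto simp: graph_cycle_def inj_on_def less_Suc_eq eval_nat_numeral)
  moreover have "singly_attached G s ((!) [a, b, c, d]) 4"
    using assms * \<open>s \<noteq> a\<close> by (auto simp: singly_attached_def less_Suc_eq eval_nat_numeral)
  ultimately show False using no_attached by blast
qed

lemma graph_iso_K4:
  assumes abc: "{a, b} \<in> G" "{b, c} \<in> G" "{c, a} \<in> G"
  shows "graph_iso G (complete_edges 4)"
proof -
  have neq: "a \<noteq> b" "b \<noteq> c" "c \<noteq> a" using abc edge_neq by blast+
  \<comment> \<open>Stated for arbitrary letters because it is used again with \<open>b\<close> and
    \<open>c\<close> exchanged.\<close>
  have common: "\<exists>s. nbrs G a = {b, c, s} \<and> nbrs G b = {a, c, s} \<and> nbrs G c = {a, b, s} \<and> s \<notin> {a, b, c}"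
    if abc: "{a, b} \<in> G" "{b, c} \<in> G" "{c, a} \<in> G" and neq: "a \<noteq> b" "b \<noteq> c" "c \<noteq> a"
      and s: "{s, a} \<in> G" "s \<noteq> b" "s \<noteq> c" "{s, b} \<in> G" for a b c s
  proof -
    have sa: "s \<noteq> a" "s \<noteq> b" using s edge_neq by blast+
    have Na: "nbrs G a = {b, c, s}"
      using abc neq s by (intro nbrs_eqI) (auto simp: nbrs_def insert_commute)
    have Nb: "nbrs G b = {a, c, s}"
      using abc neq s sa by (intro nbrs_eqI) (auto simp: nbrs_def insert_commute)
    obtain t where t: "t \<noteq> a" "t \<noteq> b" "nbrs G c = {a, b, t}" "{c, t} \<in> G"
      using third_nbr[of c a b] abc neq by (auto simp: insert_commute)
    \<comment> \<open>The vertex \<open>t\<close> needs a second neighbour on the triangle, but the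
      neighbours of \<open>a\<close> and \<open>b\<close> are already known and \<open>s\<close> is
      the only one off the triangle.\<close>
    have "t = s"
    proof (rule ccontr)
      assume "t \<noteq> s"
      have "{t, a} \<in> G \<or> {t, b} \<in> G"
        using second_nbr_triangle[of c a b t] abc t by (simp add: insert_commute)
      then have "t \<in> nbrs G a \<or> t \<in> nbrs G b" by (simp add: nbrs_def insert_commute)
      then show False using Na Nb t \<open>t \<noteq> s\<close> edge_neq by blast
    qed
    then show ?thesis using Na Nb t s sa by blast
  qed
  have "{a, c} \<in> G" using abc(3) by (simp add: insert_commute)
  then obtain s where s: "s \<noteq> b" "s \<noteq> c" "{a, s} \<in> G"
    using third_nbr[OF abc(1) _ neq(2)] by metis
  have "{s, b} \<in> G \<or> {s, c} \<in> G"
    using second_nbr_triangle[of a b c s] abc s by (simp add: insert_commute)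
  then obtain s where N: "nbrs G a = {b, c, s}" "nbrs G b = {a, c, s}" "nbrs G c = {a, b, s}" "s \<notin> {a, b, c}"
  proof
    assume "{s, b} \<in> G"
    then show ?thesis using that common[of a b c s] abc neq s by (auto simp: insert_commute)
  next
    assume "{s, c} \<in> G"
    then show ?thesis using that common[of a c b s] abc neq s by (auto simp: insert_commute)
  qed
  let ?V = "{a, b, c, s}"
  have "a \<in> nbrs G s" "b \<in> nbrs G s" "c \<in> nbrs G s"
    using N nbrs_commute by (metis insertI1 insertI2)+
  then have Ns: "nbrs G s = {a, b, c}"
    using neq by (intro nbrs_eqI) auto
  have "graph_vertices G \<subseteq> ?V"
    by (rule connected_graph_closed[OF connected, of a]) (use N Ns abc(1) in auto)
  moreover have "?V \<subseteq> graph_vertices G"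
    using N(1) nbrs_vertices[of _ G a] by auto
  ultimately have V: "graph_vertices G = ?V" by blast
  show ?thesis
  proof (rule graph_iso_complete[OF simple])
    show "card (graph_vertices G) = 4" unfolding V using N(4) neq by auto
    have "a \<noteq> s" "b \<noteq> s" "c \<noteq> s" using N(4) by auto
    then have *: "nbrs G a = ?V - {a}" "nbrs G b = ?V - {b}" "nbrs G c = ?V - {c}" "nbrs G s = ?V - {s}"
      using N(1-3) Ns neq by (auto simp: insert_Diff_if)
    show "nbrs G v = graph_vertices G - {v}" if "v \<in> graph_vertices G" for v
    proof -
      have "v = a \<or> v = b \<or> v = c \<or> v = s" using that unfolding V by simp
      then show ?thesis unfolding V using * by (elim disjE) simp_all
    qed
  qed simp
qed

lemma graph_iso_K33:
  assumes sq: "{a, b} \<in> G" "{b, c} \<in> G" "{c, d} \<in> G" "{d, a} \<in> G" "a \<noteq> c" "b \<noteq> d"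
    and triangle_free: "\<And>x y z. {x, y} \<in> G \<Longrightarrow> {y, z} \<in> G \<Longrightarrow> {z, x} \<notin> G"
  shows "graph_iso G (complete_bipartite_edges 3 3)"
proof -
  \<comment> \<open>The third neighbour of \<open>a\<close> needs a second neighbour on the square.
    Adjacency to \<open>b\<close> or \<open>d\<close> would make a triangle, so opposite corners
    share their third neighbour.\<close>
  have opposite: "\<exists>s. nbrs G a = {b, d, s} \<and> nbrs G c = {b, d, s} \<and> s \<notin> {a, b, c, d}"
    if sq: "{a, b} \<in> G" "{b, c} \<in> G" "{c, d} \<in> G" "{d, a} \<in> G" "a \<noteq> c" "b \<noteq> d" for a b c d
  proof -
    obtain s where s: "s \<noteq> b" "s \<noteq> d" "nbrs G a = {b, d, s}" "{a, s} \<in> G"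
      using third_nbr[of a b d] sq by (auto simp: insert_commute)
    have sa: "{s, a} \<in> G" using s(4) by (simp add: insert_commute)
    have "s \<noteq> c" using triangle_free[OF sq(1,2)] sa by blast
    moreover have "{s, b} \<notin> G" using triangle_free[OF sq(1), of s] sa by (metis insert_commute)
    moreover have "{s, d} \<notin> G" using triangle_free[OF sq(4) s(4)] by simp
    ultimately have "{s, c} \<in> G"
      using second_nbr_square[OF sq sa] s by blast
    then have "nbrs G c = {b, d, s}"
      using s sq by (intro nbrs_eqI) (auto simp: nbrs_def insert_commute)
    moreover have "s \<noteq> a" using s(4) edge_neq by blast
    ultimately show ?thesis using s \<open>s \<noteq> c\<close> by blast
  qed
  obtain s where s: "nbrs G a = {b, d, s}" "nbrs G c = {b, d, s}" "s \<notin> {a, b, c, d}"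
    using opposite[OF sq] by blast
  obtain t where t: "nbrs G b = {c, a, t}" "nbrs G d = {c, a, t}" "t \<notin> {a, b, c, d}"
    using opposite[of b c d a] sq by (metis insert_commute)
  have sac: "{s, a} \<in> G" "{s, c} \<in> G"
    using s by (auto simp: nbrs_def insert_commute)
  have "{s, b} \<notin> G" using triangle_free[OF sq(1), of s] sac(1) by (metis insert_commute)
  then have "s \<noteq> t" using t(1) by (auto simp: nbrs_def insert_commute)
  obtain w where w: "w \<noteq> a" "w \<noteq> c" "nbrs G s = {a, c, w}" "{s, w} \<in> G"
    using third_nbr[OF sac sq(5)] by metis
  \<comment> \<open>Apply the same principle to the square \<open>s, a, b, c\<close>, to which
    \<open>w\<close> is attached at \<open>s\<close>. The known neighbourhoods leave only
    \<open>w = d\<close> as alternative, and that closes a triangle with \<open>a\<close> and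
    \<open>s\<close>.\<close>
  have "w = t"
  proof (rule ccontr)
    assume "w \<noteq> t"
    have "w \<noteq> s" using w(4) edge_neq by blast
    have "w \<noteq> b" using w(4) \<open>{s, b} \<notin> G\<close> by blast
    have "{w, s} \<in> G" "{c, s} \<in> G" "s \<noteq> b"
      using w(4) sac(2) s(3) by (simp_all add: insert_commute)
    then have "{w, a} \<in> G \<or> {w, b} \<in> G \<or> {w, c} \<in> G"
      using second_nbr_square[OF sac(1) sq(1,2)] sq(5) w(1,2) \<open>w \<noteq> b\<close> by metis
    then have "w \<in> nbrs G a \<or> w \<in> nbrs G b \<or> w \<in> nbrs G c"
      by (simp add: nbrs_def insert_commute)
    then have "w \<in> {b, d, s} \<or> w \<in> {c, a, t}"
      unfolding s(1,2) t(1) by blast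
    then have "w = d" using w(1,2) \<open>w \<noteq> b\<close> \<open>w \<noteq> s\<close> \<open>w \<noteq> t\<close> by blast
    then show False using triangle_free[of a d s] sq(4) sac(1) w(4) by (simp add: insert_commute)
  qed
  then have Ns: "nbrs G s = {a, c, t}" using w by simp
  have neq: "a \<noteq> b" "b \<noteq> c" "c \<noteq> d" "d \<noteq> a" using sq edge_neq by blast+
  have "b \<in> nbrs G t" "d \<in> nbrs G t" "s \<in> nbrs G t"
    using t Ns nbrs_commute by (metis insertI1 insertI2)+
  then have Nt: "nbrs G t = {b, d, s}"
    using sq(6) s(3) by (intro nbrs_eqI) auto
  let ?A = "{a, c, t}" and ?B = "{b, d, s}"
  have "graph_vertices G \<subseteq> ?A \<union> ?B"
    by (rule connected_graph_closed[OF connected, of a]) (use s t Ns Nt sq(1) in auto)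
  moreover have "?A \<union> ?B \<subseteq> graph_vertices G"
    using s(1) Ns nbrs_vertices[of _ G a] nbrs_vertices[of _ G s] by auto
  ultimately have V: "graph_vertices G = ?A \<union> ?B" by blast
  show ?thesis
  proof (rule graph_iso_complete_bipartite[OF simple V])
    show "?A \<inter> ?B = {}" using s(3) t(3) neq \<open>s \<noteq> t\<close> by auto
    show "card ?A = 3" "card ?B = 3" using s(3) t(3) sq(5,6) by auto
    show "nbrs G v = ?B" if "v \<in> ?A" for v using that s Nt by auto
    show "nbrs G v = ?A" if "v \<in> ?B" for v using that t Ns by auto
  qed
qed

lemma graph_iso_K4_or_K33:
  "graph_iso G (complete_edges 4) \<or> graph_iso G (complete_bipartite_edges 3 3)"
proof -
  obtain e where "e \<in> G" using connected by (auto simp: connected_graph_def)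
  moreover obtain x y where "e = {x, y}" using simple_graph_edge[OF simple calculation] by metis
  ultimately have "graph_vertices G \<noteq> {}" by blast
  then have ex: "\<exists>k c. graph_cycle G c k" using exists_graph_cycle[OF simple cubic] by blast
  define k where "k = (LEAST k. \<exists>c. graph_cycle G c k)"
  obtain c where c: "graph_cycle G c k" using LeastI_ex[OF ex] unfolding k_def by blast
  have min: "k \<le> k'" if "graph_cycle G c' k'" for c' k'
    unfolding k_def using that by (intro Least_le) blast
  have "\<not> 5 \<le> k"
  proof
    assume "5 \<le> k"
    then have "\<exists>s. singly_attached G s c k"
      by (rule exists_singly_attached_long[OF simple cubic c]) (rule min)
    then show False using no_attached[OF c] by blast
  qed
  moreover have "3 \<le> k" using c by (simp add: graph_cycle_def)
  ultimately consider "k = 3" | "k = 4" by linarith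
  then show ?thesis
  proof cases
    case 1
    then have "{c 0, c 1} \<in> G" "{c 1, c 2} \<in> G" "{c 2, c 0} \<in> G"
      using c by (auto simp: graph_cycle_def numeral_2_eq_2)
    then show ?thesis using graph_iso_K4 by blast
  next
    case 2
    have "{c 0, c 1} \<in> G" "{c 1, c 2} \<in> G" "{c 2, c 3} \<in> G" "{c 3, c 0} \<in> G"
      using c 2 by (auto simp: graph_cycle_def numeral_2_eq_2 numeral_3_eq_3)
    moreover have "c 0 \<noteq> c 2" "c 1 \<noteq> c 3"
      using c 2 inj_onD[of c "{..<4}" 0 2] inj_onD[of c "{..<4}" 1 3] by (auto simp: graph_cycle_def)
    \<comment> \<open>Triangle-freeness need not be derived from minimality: a triangle would lead
      to \<open>K_4\<close> directly.\<close>
    ultimately show ?thesis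
      using graph_iso_K33[of "c 0" "c 1" "c 2" "c 3"] graph_iso_K4 by blast
  qed
qed

end

theorem theorem1p8:
  fixes H :: "'a set set" and M :: "nat \<Rightarrow> nat set set \<Rightarrow> bool"
  assumes "simple_graph H" and "connected_graph H" and "cubic_graph H"
    and "\<not> graph_iso H (complete_edges 4)"
    and "\<not> graph_iso H (complete_bipartite_edges 3 3)"
    and "two_rigidity_family M"
  shows "family_indep M H"
proof -
  interpret two_rigidity M using assms(6) by unfold_locales
  let ?V = "graph_vertices H"
  let ?m = "card ?V"
  have fin: "finite ?V" using finite_graph_vertices[OF assms(1)] .
  obtain f where f: "bij_betw f ?V {1..?m}"
    using finite_same_card_bij[OF fin, of "{1..?m}"] by auto
  have inj: "inj_on f ?V" and im: "f ` ?V = {1..?m}" using f by (auto simp: bij_betw_def)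
  define G where "G = relabel f H"
  have G: "simple_graph G" "connected_graph G" "cubic_graph G"
    unfolding G_def using assms(1-3) inj
    by (simp_all add: simple_graph_relabel connected_graph_relabel cubic_graph_relabel)
  have VG: "graph_vertices G = {1..?m}" unfolding G_def by (simp add: graph_vertices_relabel im)
  obtain e where e: "e \<in> H" using assms(2) by (auto simp: connected_graph_def)
  then have "card e \<le> ?m" by (intro card_mono fin) blast
  then have m: "2 \<le> ?m" using e assms(1) by (simp add: simple_graph_def)
  \<comment> \<open>Without such a configuration the classification would identify \<open>G\<close>,
    and hence \<open>H\<close>, with an excluded graph.\<close>
  have "\<exists>c k s. graph_cycle G c k \<and> singly_attached G s c k"
  proof (rule ccontr)
    assume "\<not> ?thesis"
    then interpret no_singly_attached G using G by unfold_locales auto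
    show False
      using graph_iso_K4_or_K33 graph_iso_relabel[OF inj] assms(4,5) unfolding G_def by blast
  qed
  then have "M (Suc ?m) G"
    using indep_of_singly_attached[OF m G] VG by blast
  then have "indep_copy (Suc ?m) (M (Suc ?m)) H"
    unfolding indep_copy_def G_def using inj im by (intro exI[of _ f]) auto
  then show ?thesis unfolding family_indep_def using m by (intro exI[of _ "Suc ?m"]) simp
qed

end
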